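(* Let $\mathbb K=\mathbb R$ or $\mathbb C$, let $\mathbf A\in\mathbb K^{n\times n}$ be non-singular, let $\mathbf H\in\mathbb K^{n\times n}$ be Hermitian positive definite, and let $\mathbf b,\mathbf x_0\in\mathbb K^n$ with $\mathbf r_0=\mathbf b-\mathbf A\mathbf x_0\ne\mathbf 0$. Apply GCR right preconditioned by $\mathbf H$ in the inner product induced by $\mathbf H$ (WHP-GCR). For every $i$ such that the $i$-th iterate is defined, its residual satisfies $$\frac{\|\mathbf r_{i}\|_{\mathbf H}}{\|\mathbf r_0\|_{\mathbf H}}\le\left[1-\inf_{\mathbf y\ne0}\frac{|\langle\mathbf M(\mathbf A^{-1})\mathbf y,\mathbf y\rangle|}{\langle\mathbf H\mathbf y,\mathbf y\rangle}\times\inf_{\mathbf y\ne0}\frac{|\langle\mathbf M(\mathbf A)\mathbf y,\mathbf y\rangle|}{\langle\mathbf H^{-1}\mathbf y,\mathbf y\rangle}\right]^{i/2},$$ where the infima are over nonzero $\mathbf y\in\mathbb K^n$. The same result holds for WHP-GMRES and for all truncated and restarted versions of WHP-GCR and WHP-GMRES, i.e. WHP-GCR($k$) and WHP-GMRES($k$) ($k\ge0$), WHP-Orthomin($k$) ($k\ge1$), including WHP-MR.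
   Context: $n\ge1$. $\langle\mathbf x,\mathbf y\rangle=\mathbf y^*\mathbf x$, $\langle\mathbf x,\mathbf y\rangle_{\mathbf H}=\mathbf y^*\mathbf H\mathbf x$, $\|\mathbf x\|_{\mathbf H}=\langle\mathbf x,\mathbf x\rangle_{\mathbf H}^{1/2}$. For $\mathbf B\in\mathbb K^{n\times n}$, $\mathbf M(\mathbf B)=\frac12(\mathbf B+\mathbf B^* )$ is its Hermitian part. WHP-GCR: set $\mathbf r_0=\mathbf b-\mathbf A\mathbf x_0$, $\mathbf z_0=\mathbf H\mathbf r_0$, $\mathbf p_0=\mathbf z_0$, $\mathbf q_0=\mathbf A\mathbf p_0$. For $i=0,1,\dots$: $\delta_i=\langle\mathbf q_i,\mathbf q_i\rangle_{\mathbf H}$, $\gamma_i=\langle\mathbf r_i,\mathbf q_i\rangle_{\mathbf H}$, $\alpha_i=\gamma_i/\delta_i$; $\mathbf x_{i+1}=\mathbf x_i+\alpha_i\mathbf p_i$, $\mathbf r_{i+1}=\mathbf r_i-\alpha_i\mathbf q_i$, $\mathbf z_{i+1}=\mathbf H\mathbf r_{i+1}$; $\beta_{i,j}=\langle\mathbf A\mathbf z_{i+1},\mathbf q_j\rangle_{\mathbf H}/\delta_j$ for $j=0,\dots,i$; $\mathbf p_{i+1}=\mathbf z_{i+1}-\sum_{j=0}^i\beta_{i,j}\mathbf p_j$, $\mathbf q_{i+1}=\mathbf A\mathbf z_{i+1}-\sum_{j=0}^i\beta_{i,j}\mathbf q_j$. WHP-Orthomin($k$): same algorithm except that $\mathbf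 p_{i+1}=\mathbf z_{i+1}-\sum_{j=\max(0,i-k+1)}^{i}\beta_{i,j}\mathbf p_j$ and $\mathbf q_{i+1}=\mathbf A\mathbf p_{i+1}$. WHP-MR: same algorithm except that $\mathbf p_{i+1}=\mathbf z_{i+1}$ and $\mathbf q_{i+1}=\mathbf A\mathbf p_{i+1}$. WHP-GMRES: $\mathbf x_i$ is the minimizer of $\|\mathbf b-\mathbf A\mathbf x\|_{\mathbf H}$ over $\mathbf x\in\mathbf x_0+\operatorname{span}\{\mathbf H\mathbf r_0,\mathbf H\mathbf A\mathbf H\mathbf r_0,\dots,(\mathbf H\mathbf A)^{i-1}\mathbf H\mathbf r_0\}$, and $\mathbf r_i=\mathbf b-\mathbf A\mathbf x_i$. WHP-GCR($k$), WHP-GMRES($k$): the method is run in cycles of $k+1$ iterations; each cycle runs WHP-GCR (respectively WHP-GMRES) from scratch with initial guess equal to the last iterate of the previous cycle, the iterates being numbered consecutively. For WHP-GCR, WHP-GCR($k$), WHP-Orthomin($k$) and WHP-MR, an iterate is defined as long as all the quantities $\delta_j$ by which the algorithm has divided to compute it are nonzero. *)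

theory Defs
  imports "HOL-Analysis.Analysis"
begin

text \<open>
  The scalar field is a set \<open>K\<close> of complex numbers, either \<open>\<real>\<close> or \<open>UNIV\<close>. Vectors and matrices over
  \<open>K\<close> are complex vectors and matrices with entries in \<open>K\<close>; the dimension is the cardinality
  of the finite index type.
\<close>

definition vecs_over :: "complex set \<Rightarrow> (complex^'n) set" where
  "vecs_over K = {y. \<forall>i. y $ i \<in> K}"

definition mats_over :: "complex set \<Rightarrow> (complex^'n^'n) set" where
  "mats_over K = {B. \<forall>i j. B $ i $ j \<in> K}"

definition adj :: "complex^'n^'n \<Rightarrow> complex^'n^'n" where
  "adj B = (\<chi> i j. cnj (B $ j $ i))"

definition herm_part :: "complex^'n^'n \<Rightarrow> complex^'n^'n" where
  "herm_part B = (1/2) *\<^sub>R (B + adj B)"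

text \<open>Linear in the first argument: \<open>cinner x y\<close> is \<open>y\<^sup>* x\<close> and \<open>hinner H x y\<close> is \<open>y\<^sup>* H x\<close>.\<close>

definition cinner :: "complex^'n \<Rightarrow> complex^'n \<Rightarrow> complex" where
  "cinner x y = (\<Sum>i\<in>UNIV. cnj (y $ i) * x $ i)"

definition hinner :: "complex^'n^'n \<Rightarrow> complex^'n \<Rightarrow> complex^'n \<Rightarrow> complex" where
  "hinner H x y = cinner (H *v x) y"

definition hnorm :: "complex^'n^'n \<Rightarrow> complex^'n \<Rightarrow> real" where
  "hnorm H x = sqrt (Re (hinner H x x))"

text \<open>For Hermitian \<open>H\<close> the number \<open>cinner (H *v y) y\<close> is real, so taking \<open>Re\<close> loses nothing.\<close>

definition herm_pos_def :: "complex set \<Rightarrow> complex^'n^'n \<Rightarrow> bool" where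
  "herm_pos_def K H \<longleftrightarrow>
     adj H = H \<and> (\<forall>y\<in>vecs_over K. y \<noteq> 0 \<longrightarrow> Re (cinner (H *v y) y) > 0)"

text \<open>
  The quotient of a projection onto \<open>q\<close>. With \<open>u = r\<^sub>i\<close>, \<open>q = q\<^sub>i\<close> it is \<open>\<alpha>\<^sub>i = \<gamma>\<^sub>i / \<delta>\<^sub>i\<close>; with
  \<open>u = A z\<^sub>i\<^sub>+\<^sub>1\<close>, \<open>q = q\<^sub>j\<close> it is \<open>\<beta>\<^sub>i\<^sub>,\<^sub>j\<close>.
\<close>

definition hcoef :: "complex^'n^'n \<Rightarrow> complex^'n \<Rightarrow> complex^'n \<Rightarrow> complex" where
  "hcoef H u q = hinner H u q / hinner H q q"

text \<open>
  The recursions below are total because \<open>x / 0 = 0\<close>. They agree with the algorithms as long as no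
  \<open>\<delta>\<^sub>j\<close> by which one has divided is zero: iterate \<open>i\<close> is meaningful only if \<open>\<delta>\<^sub>j \<noteq> 0\<close> for all \<open>j < i\<close>,
  and statements about it have to assume this.
\<close>

context
  notes sum.cong [fundef_cong]
  fixes A H :: "complex^'n^'n" and b x0 :: "complex^'n"
begin

function gcr_x gcr_r gcr_z gcr_p gcr_q :: "nat \<Rightarrow> complex^'n" where
  "gcr_x 0 = x0"
| "gcr_x (Suc i) = gcr_x i + hcoef H (gcr_r i) (gcr_q i) *s gcr_p i"
| "gcr_r 0 = b - A *v x0"
| "gcr_r (Suc i) = gcr_r i - hcoef H (gcr_r i) (gcr_q i) *s gcr_q i"
| "gcr_z i = H *v gcr_r i"
| "gcr_p 0 = gcr_z 0"
| "gcr_p (Suc i) =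
     gcr_z (Suc i) - (\<Sum>j\<in>{0..i}. hcoef H (A *v gcr_z (Suc i)) (gcr_q j) *s gcr_p j)"
| "gcr_q 0 = A *v gcr_p 0"
| "gcr_q (Suc i) =
     A *v gcr_z (Suc i) - (\<Sum>j\<in>{0..i}. hcoef H (A *v gcr_z (Suc i)) (gcr_q j) *s gcr_q j)"
  by pat_completeness auto
termination
  by (relation "Wellfounded.measure (\<lambda>s. case s of Inl (Inl i) \<Rightarrow> 4 * i | Inl (Inr i) \<Rightarrow> 4 * i
        | Inr (Inl i) \<Rightarrow> 4 * i + 1 | Inr (Inr (Inl i)) \<Rightarrow> 4 * i + 2 | Inr (Inr (Inr i)) \<Rightarrow> 4 * i + 3)")
    auto

definition gcr_delta :: "nat \<Rightarrow> complex" where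
  "gcr_delta i = hinner H (gcr_q i) (gcr_q i)"

text \<open>With truncated subtraction, \<open>i + 1 - k\<close> is \<open>max(0, i - k + 1)\<close>.\<close>

function orthomin_x orthomin_r orthomin_z orthomin_p orthomin_q
  :: "nat \<Rightarrow> nat \<Rightarrow> complex^'n" where
  "orthomin_x k 0 = x0"
| "orthomin_x k (Suc i) =
     orthomin_x k i + hcoef H (orthomin_r k i) (orthomin_q k i) *s orthomin_p k i"
| "orthomin_r k 0 = b - A *v x0"
| "orthomin_r k (Suc i) =
     orthomin_r k i - hcoef H (orthomin_r k i) (orthomin_q k i) *s orthomin_q k i"
| "orthomin_z k i = H *v orthomin_r k i"
| "orthomin_p k 0 = orthomin_z k 0"
| "orthomin_p k (Suc i) = orthomin_z k (Suc i) -
     (\<Sum>j\<in>{i + 1 - k..i}. hcoef H (A *v orthomin_z k (Suc i)) (orthomin_q k j) *s orthomin_p k j)"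
| "orthomin_q k i = A *v orthomin_p k i"
  by pat_completeness auto
termination
  by (relation "Wellfounded.measure (\<lambda>s. case s of Inl (Inl (k, i)) \<Rightarrow> 4 * i | Inl (Inr (k, i)) \<Rightarrow> 4 * i
        | Inr (Inl (k, i)) \<Rightarrow> 4 * i + 1 | Inr (Inr (Inl (k, i))) \<Rightarrow> 4 * i + 2
        | Inr (Inr (Inr (k, i))) \<Rightarrow> 4 * i + 3)")
    auto

definition orthomin_delta :: "nat \<Rightarrow> nat \<Rightarrow> complex" where
  "orthomin_delta k i = hinner H (orthomin_q k i) (orthomin_q k i)"

function mr_x mr_r mr_z mr_p mr_q :: "nat \<Rightarrow> complex^'n" where
  "mr_x 0 = x0"
| "mr_x (Suc i) = mr_x i + hcoef H (mr_r i) (mr_q i) *s mr_p i"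
| "mr_r 0 = b - A *v x0"
| "mr_r (Suc i) = mr_r i - hcoef H (mr_r i) (mr_q i) *s mr_q i"
| "mr_z i = H *v mr_r i"
| "mr_p i = mr_z i"
| "mr_q i = A *v mr_p i"
  by pat_completeness auto
termination
  by (relation "Wellfounded.measure (\<lambda>s. case s of Inl (Inl i) \<Rightarrow> 4 * i | Inl (Inr i) \<Rightarrow> 4 * i
        | Inr (Inl i) \<Rightarrow> 4 * i + 1 | Inr (Inr (Inl i)) \<Rightarrow> 4 * i + 2 | Inr (Inr (Inr i)) \<Rightarrow> 4 * i + 3)")
    auto

definition mr_delta :: "nat \<Rightarrow> complex" where
  "mr_delta i = hinner H (mr_q i) (mr_q i)"

end

text \<open>The recursively updated vectors \<open>r\<^sub>i\<close> are the residuals of the iterates \<open>x\<^sub>i\<close>.\<close>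

lemma matrix_vector_scale: "A *v (c *s x) = c *s (A *v x)"
  for A :: "complex^'n^'n"
  by (simp add: vector_scalar_commute)

lemma gcr_q_eq: "gcr_q A H b x0 i = A *v gcr_p A H b x0 i"
proof (induction i rule: less_induct)
  case (less i)
  show ?case
  proof (cases i)
    case 0
    then show ?thesis by simp
  next
    case (Suc m)
    have "gcr_q A H b x0 j = A *v gcr_p A H b x0 j" if "j \<in> {0..m}" for j
      using less that Suc by simp
    then show ?thesis
      by (simp add: Suc matrix_vector_mult_diff_distrib linear_sum[OF matrix_vector_mul_linear]
          matrix_vector_scale del: gcr_z.simps)
  qed
qed

lemma gcr_r_eq: "gcr_r A H b x0 i = b - A *v gcr_x A H b x0 i"
  by (induction i) (simp_all add: gcr_q_eq matrix_vector_right_distrib matrix_vector_scale algebra_simps)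

lemma orthomin_r_eq: "orthomin_r A H b x0 k i = b - A *v orthomin_x A H b x0 k i"
  by (induction i) (simp_all add: matrix_vector_right_distrib matrix_vector_scale algebra_simps
      del: orthomin_p.simps)

lemma mr_r_eq: "mr_r A H b x0 i = b - A *v mr_x A H b x0 i"
  by (induction i) (simp_all add: matrix_vector_right_distrib matrix_vector_scale algebra_simps)

text \<open>
  Iteration \<open>i\<close> of the restarted method is iteration \<open>i mod (k + 1)\<close> of cycle \<open>i div (k + 1)\<close>. Cycle
  \<open>m\<close> starts from \<open>gcr_start A H b x0 k m\<close>, the last iterate of the cycle before it.
\<close>

definition gcr_start ::
  "complex^'n^'n \<Rightarrow> complex^'n^'n \<Rightarrow> complex^'n \<Rightarrow> complex^'n \<Rightarrow> nat \<Rightarrow> nat \<Rightarrow> complex^'n" where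
  "gcr_start A H b x0 k m = ((\<lambda>x. gcr_x A H b x (k + 1)) ^^ m) x0"

definition gcr_restart_x ::
  "complex^'n^'n \<Rightarrow> complex^'n^'n \<Rightarrow> complex^'n \<Rightarrow> complex^'n \<Rightarrow> nat \<Rightarrow> nat \<Rightarrow> complex^'n" where
  "gcr_restart_x A H b x0 k i =
     gcr_x A H b (gcr_start A H b x0 k (i div (k + 1))) (i mod (k + 1))"

definition gcr_restart_delta ::
  "complex^'n^'n \<Rightarrow> complex^'n^'n \<Rightarrow> complex^'n \<Rightarrow> complex^'n \<Rightarrow> nat \<Rightarrow> nat \<Rightarrow> complex" where
  "gcr_restart_delta A H b x0 k i =
     gcr_delta A H b (gcr_start A H b x0 k (i div (k + 1))) (i mod (k + 1))"

text \<open>The span over \<open>K\<close> of \<open>(H A)\<^sup>j H r\<^sub>0\<close>, \<open>j < i\<close>.\<close>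

definition krylov ::
  "complex set \<Rightarrow> complex^'n^'n \<Rightarrow> complex^'n^'n \<Rightarrow> complex^'n \<Rightarrow> nat \<Rightarrow> (complex^'n) set" where
  "krylov K A H r0 i =
     {\<Sum>j<i. c j *s ((\<lambda>v. (H ** A) *v v) ^^ j) (H *v r0) | c. \<forall>j<i. c j \<in> K}"

definition gmres_iterate :: "complex set \<Rightarrow> complex^'n^'n \<Rightarrow> complex^'n^'n \<Rightarrow> complex^'n \<Rightarrow> complex^'n
    \<Rightarrow> nat \<Rightarrow> complex^'n \<Rightarrow> bool" where
  "gmres_iterate K A H b x0 i x \<longleftrightarrow>
     is_arg_min (\<lambda>x. hnorm H (b - A *v x)) (\<lambda>x. \<exists>v\<in>krylov K A H (b - A *v x0) i. x = x0 + v) x"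

text \<open>
  \<open>x\<close> is the sequence of iterates of the restarted method; iterate \<open>m * (k + 1) + l\<close> is iterate \<open>l\<close> of
  the cycle started from iterate \<open>m * (k + 1)\<close>.
\<close>

definition gmres_restart :: "complex set \<Rightarrow> complex^'n^'n \<Rightarrow> complex^'n^'n \<Rightarrow> complex^'n \<Rightarrow> complex^'n
    \<Rightarrow> nat \<Rightarrow> (nat \<Rightarrow> complex^'n) \<Rightarrow> bool" where
  "gmres_restart K A H b x0 k x \<longleftrightarrow>
     x 0 = x0 \<and>
     (\<forall>m. \<forall>l\<in>{1..k + 1}. gmres_iterate K A H b (x (m * (k + 1))) l (x (m * (k + 1) + l)))"

text \<open>The quantity in square brackets in the convergence estimate.\<close>

definition whp_factor :: "complex set \<Rightarrow> complex^'n^'n \<Rightarrow> complex^'n^'n \<Rightarrow> real" where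
  "whp_factor K A H =
     1 - (INF y\<in>vecs_over K - {0}.
            cmod (cinner (herm_part (matrix_inv A) *v y) y) / Re (cinner (H *v y) y))
       * (INF y\<in>vecs_over K - {0}.
            cmod (cinner (herm_part A *v y) y) / Re (cinner (matrix_inv H *v y) y))"

text \<open>
  The power \<open>whp_factor\<^bsup>i/2\<^esup>\<close>. It is written without \<open>powr\<close> because \<open>0 powr 0 = 0\<close>, while the
  estimate at \<open>i = 0\<close> needs the value 1 and \<open>whp_factor\<close> can vanish.
\<close>

definition whp_bound :: "complex set \<Rightarrow> complex^'n^'n \<Rightarrow> complex^'n^'n \<Rightarrow> nat \<Rightarrow> real" where
  "whp_bound K A H i = sqrt (whp_factor K A H) ^ i"

end

theory Submission
  imports Defs
begin

text \<open>
  Every method considered here reduces the residual, in each single step, at least as much as one step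
  of the minimal residual iteration does, and one such step already shrinks the residual by the
  square root of the factor in brackets.

  Write \<open>z = H r\<close> and \<open>w = A z\<close>. Projecting \<open>r\<close> off \<open>w\<close> lowers \<open>\<parallel>r\<parallel>\<^sub>H\<^sup>2\<close> by
  \<open>\<bar>\<langle>r, w\<rangle>\<^sub>H\<bar>\<^sup>2 / \<parallel>w\<parallel>\<^sub>H\<^sup>2\<close>. The number \<open>\<langle>r, w\<rangle>\<^sub>H\<close> is the conjugate of \<open>\<langle>A z, z\<rangle>\<close>, and it is also
  \<open>\<langle>A\<^sup>-\<^sup>1 w, w\<rangle>\<close>. The Hermitian parts therefore bound it in two ways: by the second infimum times
  \<open>\<langle>H\<^sup>-\<^sup>1 z, z\<rangle> = \<parallel>r\<parallel>\<^sub>H\<^sup>2\<close>, and by the first infimum times \<open>\<langle>H w, w\<rangle> = \<parallel>w\<parallel>\<^sub>H\<^sup>2\<close>. The product of these two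
  estimates bounds the gain in one step from below (\<open>two_sided_bound\<close>).

  Orthomin(\<open>k\<close>) projects off a direction \<open>q\<close> which is \<open>w\<close> minus its projection onto the last \<open>k\<close>
  directions, and the residual is already orthogonal to these. So \<open>\<langle>r, q\<rangle>\<^sub>H = \<langle>r, w\<rangle>\<^sub>H\<close> while
  \<open>\<parallel>q\<parallel>\<^sub>H \<le> \<parallel>w\<parallel>\<^sub>H\<close>, and the step gains at least as much (\<open>residual_reduction\<close>,
  \<open>orthomin_step\<close>). WHP-MR is the case \<open>k = 0\<close>, and WHP-GCR up to iteration \<open>i\<close> is the case
  \<open>k \<ge> i\<close>. The iterates of WHP-MR lie in the affine Krylov spaces, so the minimality of WHP-GMRES
  makes it at least as good. The estimates compare a residual with the first one of its cycle, so they
  can be chained over restarts.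
\<close>

section \<open>Sesquilinear forms\<close>

lemma cinner_add_left: "cinner (x + y) u = cinner x u + cinner y u"
  by (simp add: cinner_def algebra_simps sum.distrib)

lemma cinner_scale_left: "cinner (c *s x) u = c * cinner x u"
  by (simp add: cinner_def sum_distrib_left mult_ac)

lemma cinner_commute: "cinner y x = cnj (cinner x y)"
  by (simp add: cinner_def mult_ac)

lemma cinner_adj: "cinner (adj B *v x) y = cinner x (B *v y)"
proof -
  have "cinner (adj B *v x) y = (\<Sum>i\<in>UNIV. \<Sum>j\<in>UNIV. cnj (y $ i) * (cnj (B $ j $ i) * x $ j))"
    by (simp add: cinner_def matrix_vector_mult_def adj_def sum_distrib_left)
  also have "\<dots> = (\<Sum>j\<in>UNIV. \<Sum>i\<in>UNIV. cnj (y $ i) * (cnj (B $ j $ i) * x $ j))"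
    by (rule sum.swap)
  also have "\<dots> = cinner x (B *v y)"
    by (simp add: cinner_def matrix_vector_mult_def sum_distrib_left sum_distrib_right mult_ac)
  finally show ?thesis .
qed

text \<open>The form of the Hermitian part of \<open>B\<close> is the real part of the form of \<open>B\<close>.\<close>

lemma cinner_herm_part: "cinner (herm_part B *v y) y = of_real (Re (cinner (B *v y) y))"
proof -
  have "herm_part B $ i $ j = (1/2) * (B $ i $ j + adj B $ i $ j)" for i j
    by (simp add: herm_part_def) (simp add: scaleR_conv_of_real)
  then have "herm_part B *v y = (1/2) *s (B *v y + adj B *v y)"
    by (simp add: vec_eq_iff matrix_vector_mult_def sum.distrib[symmetric] algebra_simps
        sum_divide_distrib add_divide_distrib)
  then have "cinner (herm_part B *v y) y = (1/2) * (cinner (B *v y) y + cnj (cinner (B *v y) y))"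
    by (simp add: cinner_scale_left cinner_add_left cinner_adj cinner_commute[of y])
  then show ?thesis
    by (simp add: complex_add_cnj)
qed

lemma cmod_cinner_herm_part_le: "cmod (cinner (herm_part B *v y) y) \<le> cmod (cinner (B *v y) y)"
  by (simp add: cinner_herm_part abs_Re_le_cmod)

lemma hinner_add_left: "hinner H (x + y) u = hinner H x u + hinner H y u"
  by (simp add: hinner_def matrix_vector_right_distrib cinner_add_left)

lemma hinner_scale_left: "hinner H (c *s x) u = c * hinner H x u"
  by (simp add: hinner_def matrix_vector_scale cinner_scale_left)

lemma hinner_zero_left [simp]: "hinner H 0 u = 0"
  using hinner_scale_left[of H 0 0 u] by simp

lemma hinner_diff_left: "hinner H (x - y) u = hinner H x u - hinner H y u"
  using hinner_add_left[of H "x - y" y u] by simp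

lemma hinner_sum_left: "hinner H (\<Sum>j\<in>J. f j) u = (\<Sum>j\<in>J. hinner H (f j) u)"
  by (induction J rule: infinite_finite_induct) (simp_all add: hinner_add_left)

lemma matrix_inv_mult_cancel:
  fixes B :: "complex^'n^'n"
  assumes "invertible B"
  shows "matrix_inv B *v (B *v x) = x" and "B *v (matrix_inv B *v x) = x"
proof -
  have "B ** matrix_inv B = mat 1 \<and> matrix_inv B ** B = mat 1"
    using assms unfolding invertible_def matrix_inv_def by (rule someI_ex)
  then show "matrix_inv B *v (B *v x) = x" and "B *v (matrix_inv B *v x) = x"
    by (simp_all add: matrix_vector_mul_assoc)
qed

section \<open>Vectors over the scalar field\<close>

text \<open>
  A real symmetric matrix that is positive definite on real vectors is so on complex vectors, because
  the forms of the real and of the imaginary part of a vector add up.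
\<close>

lemma herm_pos_def_complex:
  fixes H :: "complex^'n^'n" and y :: "complex^'n"
  assumes "K = \<real> \<or> K = UNIV" "H \<in> mats_over K" "herm_pos_def K H" "y \<noteq> 0"
  shows "Re (cinner (H *v y) y) > 0"
proof (cases "K = UNIV")
  case True
  with assms show ?thesis
    by (auto simp: herm_pos_def_def vecs_over_def)
next
  case False
  with assms(1) have K: "K = \<real>" by simp
  define u v :: "complex^'n" where "u = (\<chi> i. of_real (Re (y $ i)))" and "v = (\<chi> i. of_real (Im (y $ i)))"
  have uv: "u \<in> vecs_over K" "v \<in> vecs_over K"
    by (simp_all add: u_def v_def vecs_over_def K)
  have H0: "Im (H $ i $ j) = 0" for i j
    using assms(2) by (simp add: mats_over_def K complex_is_Real_iff)
  \<comment> \<open>With real entries the mixed products of real and imaginary parts are purely imaginary.\<close>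
  have form: "Re (cinner (H *v x) x) =
      (\<Sum>i\<in>UNIV. \<Sum>j\<in>UNIV. Re (H $ i $ j) * (Re (x $ i) * Re (x $ j) + Im (x $ i) * Im (x $ j)))" for x
    by (simp add: cinner_def matrix_vector_mult_def sum_distrib_left H0 algebra_simps)
  have split: "Re (cinner (H *v y) y) = Re (cinner (H *v u) u) + Re (cinner (H *v v) v)"
    unfolding form sum.distrib[symmetric]
    by (intro sum.cong refl) (simp add: u_def v_def algebra_simps)
  have pos: "Re (cinner (H *v x) x) > 0" if "x \<in> vecs_over K" "x \<noteq> 0" for x
    using assms(3) that by (simp add: herm_pos_def_def)
  have nonneg: "Re (cinner (H *v x) x) \<ge> 0" if "x \<in> vecs_over K" for x
  proof (cases "x = 0")
    case True
    then show ?thesis by (simp add: cinner_def)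
  next
    case False
    then show ?thesis using pos[OF that] by simp
  qed
  have "u \<noteq> 0 \<or> v \<noteq> 0"
    using assms(4) by (auto simp: u_def v_def vec_eq_iff complex_eq_iff)
  then show ?thesis
    using split pos[OF uv(1)] pos[OF uv(2)] nonneg[OF uv(1)] nonneg[OF uv(2)] by linarith
qed

locale hermitian_preconditioning =
  fixes K :: "complex set" and A H :: "complex^'n^'n"
  assumes field: "K = \<real> \<or> K = UNIV"
    and A_over: "A \<in> mats_over K" and H_over: "H \<in> mats_over K"
    and inv_A: "invertible A"
    and pos_def: "herm_pos_def K H"
begin

lemma zero_in: "0 \<in> vecs_over K"
  using field by (auto simp: vecs_over_def)

lemma add_in: "x \<in> vecs_over K \<Longrightarrow> y \<in> vecs_over K \<Longrightarrow> x + y \<in> vecs_over K"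
  using field by (auto simp: vecs_over_def)

lemma diff_in: "x \<in> vecs_over K \<Longrightarrow> y \<in> vecs_over K \<Longrightarrow> x - y \<in> vecs_over K"
  using field by (auto simp: vecs_over_def)

lemma scale_in: "c \<in> K \<Longrightarrow> x \<in> vecs_over K \<Longrightarrow> c *s x \<in> vecs_over K"
  using field by (auto simp: vecs_over_def)

lemma sum_in: "(\<And>j. j \<in> J \<Longrightarrow> f j \<in> vecs_over K) \<Longrightarrow> (\<Sum>j\<in>J. f j) \<in> vecs_over K"
  by (induction J rule: infinite_finite_induct) (simp_all add: add_in zero_in)

lemma mult_in: "B \<in> mats_over K \<Longrightarrow> x \<in> vecs_over K \<Longrightarrow> B *v x \<in> vecs_over K"
  using field by (auto simp: vecs_over_def mats_over_def matrix_vector_mult_def intro!: sum_in_Reals)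

lemma cinner_in: "x \<in> vecs_over K \<Longrightarrow> y \<in> vecs_over K \<Longrightarrow> cinner x y \<in> K"
  using field by (auto simp: vecs_over_def cinner_def Reals_cnj_iff intro!: sum_in_Reals)

lemma hcoef_in: "x \<in> vecs_over K \<Longrightarrow> y \<in> vecs_over K \<Longrightarrow> hcoef H x y \<in> K"
  using cinner_in[OF mult_in[OF H_over]] field by (auto simp: hcoef_def hinner_def)

section \<open>The inner product induced by the preconditioner\<close>

lemma hinner_pos: "y \<noteq> 0 \<Longrightarrow> Re (hinner H y y) > 0"
  unfolding hinner_def by (rule herm_pos_def_complex[OF field H_over pos_def])

lemma hinner_commute: "hinner H y x = cnj (hinner H x y)"
proof -
  have "hinner H y x = cinner (adj H *v y) x"
    using pos_def by (simp add: hinner_def herm_pos_def_def)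
  also have "\<dots> = cnj (hinner H x y)"
    by (simp add: cinner_adj hinner_def cinner_commute[of y])
  finally show ?thesis .
qed

lemma hinner_scale_right: "hinner H u (c *s x) = cnj c * hinner H u x"
  by (metis hinner_commute hinner_scale_left complex_cnj_mult)

lemma hinner_add_right: "hinner H u (x + y) = hinner H u x + hinner H u y"
  by (metis hinner_commute hinner_add_left complex_cnj_add)

lemma hinner_diff_right: "hinner H u (x - y) = hinner H u x - hinner H u y"
  by (metis hinner_commute hinner_diff_left complex_cnj_diff)

lemma hinner_zero_right [simp]: "hinner H u 0 = 0"
  using hinner_commute[of u 0] by simp

lemma hinner_sum_right: "hinner H u (\<Sum>j\<in>J. f j) = (\<Sum>j\<in>J. hinner H u (f j))"
  by (induction J rule: infinite_finite_induct) (simp_all add: hinner_add_right)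

lemma hinner_self_nonneg: "Re (hinner H x x) \<ge> 0"
  using hinner_pos[of x] by (cases "x = 0") auto

lemma hnorm_sq: "(hnorm H x)\<^sup>2 = Re (hinner H x x)"
  by (simp add: hnorm_def hinner_self_nonneg)

lemma hinner_self: "hinner H x x = of_real ((hnorm H x)\<^sup>2)"
proof -
  have "Im (hinner H x x) = 0"
    using hinner_commute[of x x] by (simp add: complex_eq_iff)
  then show ?thesis by (simp add: hnorm_sq complex_eq_iff)
qed

lemma hnorm_nonneg [simp]: "hnorm H x \<ge> 0"
  by (simp add: hnorm_def hinner_self_nonneg)

lemma hnorm_zero [simp]: "hnorm H 0 = 0"
  by (simp add: hnorm_def)

lemma hnorm_pos: "x \<noteq> 0 \<Longrightarrow> hnorm H x > 0"
  by (simp add: hnorm_def hinner_pos)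

lemma hnorm_le_add_orth:
  assumes "hinner H x y = 0"
  shows "hnorm H x \<le> hnorm H (x + y)"
proof -
  have "hinner H y x = 0" using assms hinner_commute[of y x] by simp
  then show ?thesis
    using assms by (simp add: hnorm_def hinner_add_left hinner_add_right hinner_self_nonneg)
qed

text \<open>At \<open>q = 0\<close> this holds because every vector is orthogonal to zero.\<close>

lemma hinner_project: "hinner H (u - hcoef H u q *s q) q = 0"
  using hinner_pos[of q]
  by (cases "q = 0") (auto simp: hcoef_def hinner_diff_left hinner_scale_left)

lemma hnorm_project:
  "(hnorm H (u - hcoef H u q *s q))\<^sup>2 = (hnorm H u)\<^sup>2 - (cmod (hinner H u q))\<^sup>2 / (hnorm H q)\<^sup>2"
proof -
  have "(hnorm H (u - hcoef H u q *s q))\<^sup>2 = Re (hinner H (u - hcoef H u q *s q) u)"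
    by (simp add: hnorm_sq hinner_diff_right hinner_scale_right hinner_project)
  also have "\<dots> = (hnorm H u)\<^sup>2 - Re (hcoef H u q * cnj (hinner H u q))"
    by (simp add: hnorm_sq hinner_diff_left hinner_scale_left hinner_commute[of q u])
  also have "hcoef H u q * cnj (hinner H u q) = of_real ((cmod (hinner H u q))\<^sup>2 / (hnorm H q)\<^sup>2)"
    by (simp add: hcoef_def hinner_self[of q] complex_norm_square del: of_real_power)
  finally show ?thesis by simp
qed

lemma inv_H: "invertible H"
proof -
  have "inj ((*v) H)"
  proof (rule injI)
    fix x y assume "H *v x = H *v y"
    then have "H *v (x - y) = 0" by (simp add: matrix_vector_mult_diff_distrib)
    then have "hinner H (x - y) (x - y) = 0" by (simp add: hinner_def cinner_def)
    then show "x = y" using hinner_pos[of "x - y"] by auto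
  qed
  then show ?thesis
    by (simp add: invertible_left_inverse matrix_left_invertible_injective)
qed

lemma cinner_inv_H: "Re (cinner (matrix_inv H *v (H *v x)) (H *v x)) = (hnorm H x)\<^sup>2"
  by (simp add: matrix_inv_mult_cancel inv_H hnorm_sq hinner_def cinner_commute[of x])

section \<open>The gain of one step\<close>

lemma rayleigh_bound_inv_A:
  assumes "y \<in> vecs_over K - {0}"
  defines "\<mu> \<equiv> INF y\<in>vecs_over K - {0}.
            cmod (cinner (herm_part (matrix_inv A) *v y) y) / Re (cinner (H *v y) y)"
  shows "\<mu> \<ge> 0" and "\<mu> * (hnorm H y)\<^sup>2 \<le> cmod (cinner (matrix_inv A *v y) y)"
proof -
  let ?f = "\<lambda>y. cmod (cinner (herm_part (matrix_inv A) *v y) y) / Re (cinner (H *v y) y)"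
  have f: "?f x \<ge> 0" for x
    using hinner_self_nonneg[of x] by (simp add: hinner_def)
  show "\<mu> \<ge> 0"
    unfolding \<mu>_def using assms f by (intro cINF_greatest) auto
  have "\<mu> \<le> ?f y"
    unfolding \<mu>_def using assms f by (intro cINF_lower bdd_belowI2[where m = 0]) auto
  then have "\<mu> * (hnorm H y)\<^sup>2 \<le> cmod (cinner (herm_part (matrix_inv A) *v y) y)"
    using hinner_pos[of y] assms by (simp add: hnorm_sq hinner_def field_simps)
  then show "\<mu> * (hnorm H y)\<^sup>2 \<le> cmod (cinner (matrix_inv A *v y) y)"
    using cmod_cinner_herm_part_le order_trans by blast
qed

lemma rayleigh_bound_A:
  assumes "r \<in> vecs_over K" "r \<noteq> 0"
  defines "\<mu> \<equiv> INF y\<in>vecs_over K - {0}.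
            cmod (cinner (herm_part A *v y) y) / Re (cinner (matrix_inv H *v y) y)"
  shows "\<mu> \<ge> 0" and "\<mu> * (hnorm H r)\<^sup>2 \<le> cmod (cinner (A *v (H *v r)) (H *v r))"
proof -
  let ?f = "\<lambda>y. cmod (cinner (herm_part A *v y) y) / Re (cinner (matrix_inv H *v y) y)"
  have "Re (cinner (matrix_inv H *v x) x) \<ge> 0" for x
    using cinner_inv_H[of "matrix_inv H *v x"] by (simp add: matrix_inv_mult_cancel inv_H)
  then have f: "?f x \<ge> 0" for x by simp
  show "\<mu> \<ge> 0"
    unfolding \<mu>_def using assms f by (intro cINF_greatest) auto
  have "H *v r \<noteq> 0"
    using assms(2) matrix_inv_mult_cancel(1)[OF inv_H, of r] by auto
  then have "H *v r \<in> vecs_over K - {0}"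
    using assms(1) mult_in[OF H_over] by simp
  then have "\<mu> \<le> ?f (H *v r)"
    unfolding \<mu>_def using f by (intro cINF_lower bdd_belowI2[where m = 0]) auto
  then have "\<mu> * (hnorm H r)\<^sup>2 \<le> cmod (cinner (herm_part A *v (H *v r)) (H *v r))"
    using hnorm_pos[OF assms(2)] by (simp add: cinner_inv_H field_simps)
  then show "\<mu> * (hnorm H r)\<^sup>2 \<le> cmod (cinner (A *v (H *v r)) (H *v r))"
    using cmod_cinner_herm_part_le order_trans by blast
qed

text \<open>
  The form \<open>\<langle>r, A H r\<rangle>\<^sub>H\<close> is bounded below by either infimum, because it can be read as the form of
  \<open>A\<close> at \<open>H r\<close> and as the form of \<open>A\<^sup>-\<^sup>1\<close> at \<open>A H r\<close>.
\<close>

lemma two_sided_bound: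
  assumes "r \<in> vecs_over K" "r \<noteq> 0"
  shows "whp_factor K A H \<le> 1"
    and "(1 - whp_factor K A H) * ((hnorm H (A *v (H *v r)))\<^sup>2 * (hnorm H r)\<^sup>2)
           \<le> (cmod (hinner H r (A *v (H *v r))))\<^sup>2"
    and "A *v (H *v r) \<noteq> 0"
proof -
  define w where "w = A *v (H *v r)"
  have r_eq: "r = matrix_inv H *v (matrix_inv A *v w)"
    by (simp add: w_def matrix_inv_mult_cancel inv_A inv_H)
  show w0: "A *v (H *v r) \<noteq> 0"
    using r_eq assms(2) by (auto simp: w_def)
  have w_in: "w \<in> vecs_over K - {0}"
    using w0 assms(1) by (simp add: w_def mult_in A_over H_over)
  define \<mu> where "\<mu> = (INF y\<in>vecs_over K - {0}.
            cmod (cinner (herm_part (matrix_inv A) *v y) y) / Re (cinner (H *v y) y))"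
  define \<nu> where "\<nu> = (INF y\<in>vecs_over K - {0}.
            cmod (cinner (herm_part A *v y) y) / Re (cinner (matrix_inv H *v y) y))"
  have factor: "1 - whp_factor K A H = \<mu> * \<nu>"
    by (simp add: whp_factor_def \<mu>_def \<nu>_def)
  have \<mu>: "\<mu> \<ge> 0" "\<mu> * (hnorm H w)\<^sup>2 \<le> cmod (hinner H r w)"
    using rayleigh_bound_inv_A[OF w_in]
    by (simp_all add: \<mu>_def w_def matrix_inv_mult_cancel inv_A hinner_def)
  have \<nu>: "\<nu> \<ge> 0" "\<nu> * (hnorm H r)\<^sup>2 \<le> cmod (hinner H r w)"
    using rayleigh_bound_A[OF assms]
    by (simp_all add: \<nu>_def w_def hinner_def cinner_commute[of "A *v (H *v r)"])
  show "whp_factor K A H \<le> 1"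
    using factor mult_nonneg_nonneg[OF \<mu>(1) \<nu>(1)] by linarith
  have "(\<mu> * (hnorm H w)\<^sup>2) * (\<nu> * (hnorm H r)\<^sup>2) \<le> cmod (hinner H r w) * cmod (hinner H r w)"
    using \<mu> \<nu> by (intro mult_mono) auto
  then show "(1 - whp_factor K A H) * ((hnorm H (A *v (H *v r)))\<^sup>2 * (hnorm H r)\<^sup>2)
           \<le> (cmod (hinner H r (A *v (H *v r))))\<^sup>2"
    by (simp add: factor w_def[symmetric] power2_eq_square mult_ac)
qed

text \<open>
  Shortening the direction \<open>A H r\<close> without changing its inner product with \<open>r\<close> can only increase the
  gain of the projection.
\<close>

lemma residual_reduction:
  assumes r: "r \<in> vecs_over K"
    and inner: "hinner H r q = hinner H r (A *v (H *v r))"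
    and norm: "hnorm H q \<le> hnorm H (A *v (H *v r))"
  shows "hnorm H (r - hcoef H r q *s q) \<le> sqrt (whp_factor K A H) * hnorm H r"
proof (cases "r = 0")
  case True
  then show ?thesis by (simp add: hcoef_def)
next
  case False
  define w c g where "w = A *v (H *v r)" and "c = (cmod (hinner H r w))\<^sup>2" and "g = 1 - whp_factor K A H"
  have g: "g \<ge> 0" "g * ((hnorm H w)\<^sup>2 * (hnorm H r)\<^sup>2) \<le> c" and w: "w \<noteq> 0"
    using two_sided_bound[OF r False] by (simp_all add: g_def w_def c_def)
  have gain: "g * (hnorm H r)\<^sup>2 \<le> c / (hnorm H q)\<^sup>2"
  proof (cases "q = 0")
    case True
    \<comment> \<open>If the direction vanishes, so do the inner product and hence the guaranteed gain.\<close>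
    then have "c = 0" using inner by (simp add: c_def w_def)
    then have "g = 0"
      using g hnorm_pos[OF w] hnorm_pos[OF False]
      by (metis mult_pos_pos zero_less_power not_less less_eq_real_def)
    then show ?thesis by (simp add: c_def)
  next
    case False
    have "g * (hnorm H r)\<^sup>2 * (hnorm H q)\<^sup>2 \<le> g * (hnorm H r)\<^sup>2 * (hnorm H w)\<^sup>2"
      using norm g(1) by (intro mult_left_mono power_mono) (auto simp: w_def)
    then show ?thesis
      using g(2) hnorm_pos[OF False] by (simp add: pos_le_divide_eq mult_ac)
  qed
  have "(hnorm H (r - hcoef H r q *s q))\<^sup>2 = (hnorm H r)\<^sup>2 - c / (hnorm H q)\<^sup>2"
    using inner by (simp add: hnorm_project c_def w_def)
  also have "\<dots> \<le> whp_factor K A H * (hnorm H r)\<^sup>2"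
    using gain by (simp add: g_def algebra_simps)
  finally have "sqrt ((hnorm H (r - hcoef H r q *s q))\<^sup>2) \<le> sqrt (whp_factor K A H * (hnorm H r)\<^sup>2)"
    by (rule real_sqrt_le_mono)
  then show ?thesis
    by (simp add: real_sqrt_mult)
qed

text \<open>
  The square root of the factor bounds the ratio of two norms at some nonzero vector. Without this
  the single steps could not be multiplied up, as \<open>sqrt\<close> takes negative values at negative
  arguments.
\<close>

lemma rate_nonneg: "sqrt (whp_factor K A H) \<ge> 0"
proof -
  define r :: "complex^'n" where "r = (\<chi> i. 1)"
  have r: "r \<in> vecs_over K" "r \<noteq> 0"
    using field by (auto simp: r_def vecs_over_def vec_eq_iff)
  have "0 \<le> sqrt (whp_factor K A H) * hnorm H r"
    using residual_reduction[OF r(1) refl order_refl] hnorm_nonneg order_trans by blast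
  then show ?thesis
    using hnorm_pos[OF r(2)] by (simp add: zero_le_mult_iff)
qed

lemma whp_bound_nonneg: "whp_bound K A H i \<ge> 0"
  by (simp only: whp_bound_def zero_le_power[OF rate_nonneg])

lemma bound_of_steps:
  assumes "\<And>j. hnorm H (r (Suc j)) \<le> sqrt (whp_factor K A H) * hnorm H (r j)"
  shows "hnorm H (r i) \<le> whp_bound K A H i * hnorm H (r 0)"
proof (induction i)
  case 0
  then show ?case by (simp add: whp_bound_def)
next
  case (Suc i)
  have "hnorm H (r (Suc i)) \<le> sqrt (whp_factor K A H) * (whp_bound K A H i * hnorm H (r 0))"
    using assms[of i] mult_left_mono[OF Suc rate_nonneg] by linarith
  then show ?case by (simp add: whp_bound_def)
qed

section \<open>Truncated methods\<close>

text \<open>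
  The window before the index \<open>0\<close> is empty, so one formula serves the first and all later directions.
\<close>

lemma orthomin_q_window:
  fixes b x :: "complex^'n" and k i :: nat
  defines "w \<equiv> A *v (H *v orthomin_r A H b x k i)"
  shows "orthomin_q A H b x k i = w
    - (\<Sum>j\<in>{i - k..<i}. hcoef H w (orthomin_q A H b x k j) *s orthomin_q A H b x k j)"
proof (cases i)
  case 0
  then show ?thesis by (simp add: w_def)
next
  case (Suc m)
  have "{Suc m - k..<Suc m} = {m + 1 - k..m}" by auto
  then show ?thesis
    by (simp add: Suc w_def matrix_vector_mult_diff_distrib matrix_vector_scale
        linear_sum[OF matrix_vector_mul_linear] del: orthomin_r.simps)
qed

text \<open>
  Any two indices in the window of length \<open>k\<close> before \<open>l\<close> are less than \<open>k\<close> apart, so by induction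
  their directions are orthogonal. Subtracting the single projections from \<open>A H r\<^sub>l\<close> therefore
  projects off their span, as in the Gram-Schmidt process. The residual inherits
  orthogonality from the previous one because the window at \<open>l\<close> lies in the one at \<open>l - 1\<close> except
  for the index \<open>l - 1\<close>, which the latest step has projected off.
\<close>

lemma orthomin_orthogonal:
  assumes "j < l" "l \<le> j + k"
  shows "hinner H (orthomin_q A H b x k l) (orthomin_q A H b x k j) = 0
    \<and> hinner H (orthomin_r A H b x k l) (orthomin_q A H b x k j) = 0"
  using assms
proof (induction l arbitrary: j rule: less_induct)
  case (less l)
  let ?q = "orthomin_q A H b x k" and ?r = "orthomin_r A H b x k"
  obtain i where i: "l = Suc i" using less.prems by (cases l) auto
  have r_Suc: "?r l = ?r i - hcoef H (?r i) (?q i) *s ?q i"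
    by (simp add: i del: orthomin_q.simps)
  have "hinner H (?r l) (?q j) = 0"
  proof (cases "j = i")
    case True
    then show ?thesis by (simp add: r_Suc hinner_project del: orthomin_q.simps)
  next
    case False
    then have "hinner H (?q i) (?q j) = 0" "hinner H (?r i) (?q j) = 0"
      using less.IH[of i j] less.prems i by simp_all
    then show ?thesis
      by (simp add: r_Suc hinner_diff_left hinner_scale_left del: orthomin_q.simps)
  qed
  moreover have "hinner H (?q l) (?q j) = 0"
  proof -
    define w where "w = A *v (H *v ?r l)"
    have orth: "hinner H (?q t) (?q j) = 0" if "t \<in> {l - k..<l}" "t \<noteq> j" for t
    proof (cases "t < j")
      case True
      then have "hinner H (?q j) (?q t) = 0"
        using less.IH[of j t] less.prems that by auto
      then show ?thesis using hinner_commute[of "?q t" "?q j"] by simp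
    next
      case False
      then show ?thesis using less.IH[of t j] less.prems that by auto
    qed
    have "hinner H (?q l) (?q j)
        = hinner H w (?q j) - (\<Sum>t\<in>{l - k..<l}. hcoef H w (?q t) * hinner H (?q t) (?q j))"
      by (subst orthomin_q_window)
        (simp add: w_def hinner_diff_left hinner_sum_left hinner_scale_left del: orthomin_q.simps)
    also have "(\<Sum>t\<in>{l - k..<l}. hcoef H w (?q t) * hinner H (?q t) (?q j))
        = (\<Sum>t\<in>{l - k..<l}. if t = j then hcoef H w (?q j) * hinner H (?q j) (?q j) else 0)"
      using orth by (intro sum.cong) auto
    also have "\<dots> = hcoef H w (?q j) * hinner H (?q j) (?q j)"
      using less.prems by (auto simp del: orthomin_q.simps)
    finally show ?thesis
      using hinner_project[of w "?q j"]
      by (simp add: hinner_diff_left hinner_scale_left del: orthomin_q.simps)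
  qed
  ultimately show ?case by simp
qed

lemma orthomin_in:
  assumes "b \<in> vecs_over K" "x \<in> vecs_over K"
  shows "orthomin_r A H b x k i \<in> vecs_over K \<and> orthomin_p A H b x k i \<in> vecs_over K
    \<and> orthomin_x A H b x k i \<in> vecs_over K"
proof (induction i rule: less_induct)
  case (less i)
  let ?r = "orthomin_r A H b x k" and ?q = "orthomin_q A H b x k" and ?p = "orthomin_p A H b x k"
  have q: "?q j \<in> vecs_over K" if "j < i" for j
    using less[OF that] by (simp add: mult_in A_over)
  show ?case
  proof (cases i)
    case 0
    then show ?thesis using assms by (simp add: mult_in A_over H_over diff_in)
  next
    case (Suc m)
    have coef: "hcoef H (?r m) (?q m) \<in> K"
      using less[of m] q[of m] Suc by (intro hcoef_in) auto
    have r: "?r (Suc m) \<in> vecs_over K"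
      using coef less[of m] q[of m] Suc
      by (simp add: diff_in scale_in del: orthomin_q.simps)
    have "?p (Suc m) \<in> vecs_over K"
      unfolding orthomin_p.simps orthomin_z.simps
      using r less q Suc
      by (intro diff_in sum_in scale_in hcoef_in mult_in A_over H_over) auto
    moreover have "orthomin_x A H b x k (Suc m) \<in> vecs_over K"
      unfolding orthomin_x.simps using coef less[of m] Suc by (intro add_in scale_in) auto
    ultimately show ?thesis using r Suc by simp
  qed
qed

text \<open>
  The subtracted part \<open>s\<close> of \<open>A H r\<close> is orthogonal to the new direction, which is therefore no longer
  than \<open>A H r\<close>, and orthogonal to the residual, whose inner product with the direction is therefore
  that with \<open>A H r\<close>.
\<close>

lemma orthomin_step:
  assumes "b \<in> vecs_over K" "x \<in> vecs_over K"
  shows "hnorm H (orthomin_r A H b x k (Suc i)) \<le> sqrt (whp_factor K A H) * hnorm H (orthomin_r A H b x k i)"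
proof -
  let ?r = "orthomin_r A H b x k i" and ?q = "orthomin_q A H b x k"
  define w where "w = A *v (H *v ?r)"
  define s where "s = (\<Sum>j\<in>{i - k..<i}. hcoef H w (?q j) *s ?q j)"
  have qi: "?q i = w - s"
    by (subst orthomin_q_window) (simp add: s_def w_def)
  have orth: "hinner H (?q i) (?q j) = 0" "hinner H ?r (?q j) = 0" if "j \<in> {i - k..<i}" for j
    using orthomin_orthogonal[of j i k] that by auto
  have s: "hinner H (?q i) s = 0" "hinner H ?r s = 0"
    using orth by (simp_all add: s_def hinner_sum_right hinner_scale_right del: orthomin_q.simps)
  have "hinner H ?r (?q i) = hinner H ?r w"
    unfolding qi using s(2) by (simp add: hinner_diff_right)
  moreover have "hnorm H (?q i) \<le> hnorm H w"
    using hnorm_le_add_orth[OF s(1)] qi by simp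
  ultimately have "hnorm H (?r - hcoef H ?r (?q i) *s ?q i) \<le> sqrt (whp_factor K A H) * hnorm H ?r"
    unfolding w_def using orthomin_in[OF assms] by (intro residual_reduction) auto
  then show ?thesis by simp
qed

lemma orthomin_bound:
  assumes "b \<in> vecs_over K" "x \<in> vecs_over K"
  shows "hnorm H (b - A *v orthomin_x A H b x k i) \<le> whp_bound K A H i * hnorm H (b - A *v x)"
  using bound_of_steps[where r = "orthomin_r A H b x k" and i = i, OF orthomin_step[OF assms]] by (simp add: orthomin_r_eq)

end

text \<open>Truncation to an empty window leaves no previous directions.\<close>

lemma mr_eq_orthomin:
  "mr_x A H b x i = orthomin_x A H b x 0 i \<and> mr_r A H b x i = orthomin_r A H b x 0 i
    \<and> mr_p A H b x i = orthomin_p A H b x 0 i"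
proof (induction i)
  case 0
  then show ?case by simp
next
  case (Suc i)
  then have "mr_q A H b x i = orthomin_q A H b x 0 i"
    by (simp only: mr_q.simps orthomin_q.simps)
  then have r: "mr_r A H b x (Suc i) = orthomin_r A H b x 0 (Suc i)"
    and x: "mr_x A H b x (Suc i) = orthomin_x A H b x 0 (Suc i)"
    using Suc by (simp_all only: mr_r.simps orthomin_r.simps mr_x.simps orthomin_x.simps)
  moreover have "orthomin_p A H b x 0 (Suc i) = orthomin_z A H b x 0 (Suc i)"
    by (simp del: orthomin_z.simps)
  ultimately show ?case
    by (simp only: mr_p.simps mr_z.simps orthomin_z.simps)
qed

text \<open>A window that reaches back to the first direction truncates nothing.\<close>

lemma gcr_eq_orthomin:
  assumes "i \<le> k"
  shows "gcr_r A H b x i = orthomin_r A H b x k i \<and> gcr_p A H b x i = orthomin_p A H b x k i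
    \<and> gcr_x A H b x i = orthomin_x A H b x k i"
  using assms
proof (induction i rule: less_induct)
  case (less i)
  have q: "gcr_q A H b x j = orthomin_q A H b x k j" if "j < i" for j
    using less.IH[OF that] less.prems that by (simp add: gcr_q_eq)
  show ?case
  proof (cases i)
    case 0
    then show ?thesis by simp
  next
    case (Suc m)
    have IH: "gcr_r A H b x m = orthomin_r A H b x k m" "gcr_p A H b x m = orthomin_p A H b x k m"
        "gcr_x A H b x m = orthomin_x A H b x k m"
      using less Suc by auto
    have r: "gcr_r A H b x (Suc m) = orthomin_r A H b x k (Suc m)"
      and x: "gcr_x A H b x (Suc m) = orthomin_x A H b x k (Suc m)"
      using IH q[of m] Suc
      by (simp_all del: gcr_p.simps orthomin_p.simps gcr_q.simps orthomin_q.simps)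
    have "gcr_p A H b x (Suc m) = orthomin_p A H b x k (Suc m)"
    proof -
      have window: "{m + 1 - k..m} = {0..m}" using less.prems Suc by simp
      show ?thesis
        unfolding gcr_p.simps orthomin_p.simps gcr_z.simps orthomin_z.simps r window
        using less q Suc by (intro arg_cong2[where f = minus] sum.cong refl) auto
    qed
    then show ?thesis using r x Suc by blast
  qed
qed

section \<open>Minimization over Krylov spaces and restarts\<close>

text \<open>
  A step of WHP-MR adds a multiple of \<open>H r = H r\<^sub>0 - H A v\<close> to the current correction \<open>v\<close>, which
  involves just one further power of \<open>H A\<close>.
\<close>

lemma krylov_step:
  assumes "K = \<real> \<or> K = UNIV" "v \<in> krylov K A H r0 i" "a \<in> K"
  shows "v + a *s (H *v (r0 - A *v v)) \<in> krylov K A H r0 (Suc i)"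
proof -
  define g where "g j = ((\<lambda>v. (H ** A) *v v) ^^ j) (H *v r0)" for j
  obtain c where v: "v = (\<Sum>j<i. c j *s g j)" and c: "\<forall>j<i. c j \<in> K"
    using assms(2) unfolding krylov_def g_def by auto
  define d where "d j = (if j < i then c j else 0) + (if j = 0 then a else - (a * c (j - 1)))" for j
  have "H *v (A *v v) = (\<Sum>j<i. c j *s g (Suc j))"
    by (simp add: v g_def matrix_vector_mul_assoc linear_sum[OF matrix_vector_mul_linear]
        matrix_vector_scale)
  then have "v + a *s (H *v (r0 - A *v v)) = v + (a *s g 0 - (\<Sum>j<i. (a * c j) *s g (Suc j)))"
    by (simp add: g_def matrix_vector_mult_diff_distrib vec_eq_iff sum_distrib_left algebra_simps)
  also have "\<dots> = (\<Sum>j<Suc i. (if j < i then c j else 0) *s g j)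
      + (a *s g 0 - (\<Sum>j<i. (a * c j) *s g (Suc j)))"
    by (simp add: v)
  also have "a *s g 0 - (\<Sum>j<i. (a * c j) *s g (Suc j))
      = (\<Sum>j<Suc i. (if j = 0 then a else - (a * c (j - 1))) *s g j)"
    by (subst sum.lessThan_Suc_shift) (simp add: vec_eq_iff sum_negf)
  also have "(\<Sum>j<Suc i. (if j < i then c j else 0) *s g j) + \<dots> = (\<Sum>j<Suc i. d j *s g j)"
    unfolding d_def sum.distrib[symmetric] by (intro sum.cong refl) (simp add: vector_sadd_rdistrib)
  finally have "v + a *s (H *v (r0 - A *v v)) = (\<Sum>j<Suc i. d j *s g j)" .
  moreover have "\<forall>j<Suc i. d j \<in> K"
    using assms(1,3) c by (auto simp: d_def)
  ultimately show ?thesis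
    unfolding krylov_def g_def by blast
qed

context hermitian_preconditioning
begin

lemma mr_bound:
  assumes "b \<in> vecs_over K" "x \<in> vecs_over K"
  shows "hnorm H (b - A *v mr_x A H b x i) \<le> whp_bound K A H i * hnorm H (b - A *v x)"
  using orthomin_bound[OF assms, of 0 i] by (simp add: mr_eq_orthomin)

lemma mr_in_krylov:
  assumes "b \<in> vecs_over K" "x \<in> vecs_over K"
  shows "mr_x A H b x i - x \<in> krylov K A H (b - A *v x) i"
proof (induction i)
  case 0
  then show ?case by (simp add: krylov_def)
next
  case (Suc i)
  let ?a = "hcoef H (mr_r A H b x i) (mr_q A H b x i)" and ?v = "mr_x A H b x i - x"
  have r: "mr_r A H b x i \<in> vecs_over K"
    using orthomin_in[OF assms] by (simp add: mr_eq_orthomin)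
  then have "?a \<in> K"
    by (simp add: hcoef_in mult_in A_over H_over)
  then have "?v + ?a *s (H *v (b - A *v x - A *v ?v)) \<in> krylov K A H (b - A *v x) (Suc i)"
    by (intro krylov_step field Suc)
  moreover have "b - A *v x - A *v ?v = mr_r A H b x i"
    by (simp add: mr_r_eq matrix_vector_mult_diff_distrib)
  moreover have "?v + ?a *s (H *v mr_r A H b x i) = mr_x A H b x (Suc i) - x"
    by (simp add: algebra_simps)
  ultimately show ?case
    by (simp only:)
qed

text \<open>
  The WHP-MR iterate with the same index is one of the competitors in the minimization.
\<close>

lemma gmres_bound:
  assumes "b \<in> vecs_over K" "x \<in> vecs_over K" "gmres_iterate K A H b x i y"
  shows "hnorm H (b - A *v y) \<le> whp_bound K A H i * hnorm H (b - A *v x)"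
proof -
  have "\<exists>v\<in>krylov K A H (b - A *v x) i. mr_x A H b x i = x + v"
    using mr_in_krylov[OF assms(1,2)] by (intro bexI[of _ "mr_x A H b x i - x"]) auto
  then have "hnorm H (b - A *v y) \<le> hnorm H (b - A *v mr_x A H b x i)"
    using assms(3) by (auto simp: gmres_iterate_def is_arg_min_linorder)
  then show ?thesis
    using mr_bound[OF assms(1,2), of i] by linarith
qed

lemma krylov_in:
  assumes "r \<in> vecs_over K" "v \<in> krylov K A H r i"
  shows "v \<in> vecs_over K"
proof -
  have "((\<lambda>v. (H ** A) *v v) ^^ j) (H *v r) \<in> vecs_over K" for j
    by (induction j)
      (simp_all add: assms(1) mult_in A_over H_over matrix_vector_mul_assoc[symmetric])
  then show ?thesis
    using assms(2) by (auto simp: krylov_def intro!: sum_in scale_in)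
qed

lemma gmres_in:
  assumes "b \<in> vecs_over K" "x \<in> vecs_over K" "gmres_iterate K A H b x i y"
  shows "y \<in> vecs_over K"
proof -
  obtain v where v: "v \<in> krylov K A H (b - A *v x) i" and y: "y = x + v"
    using assms(3) by (auto simp: gmres_iterate_def is_arg_min_def)
  have "b - A *v x \<in> vecs_over K"
    using assms(1,2) by (intro diff_in mult_in A_over)
  then show ?thesis
    unfolding y using v assms(2) add_in krylov_in by blast
qed

lemma whp_bound_chain:
  assumes "hnorm H u \<le> whp_bound K A H i * hnorm H v" "hnorm H v \<le> whp_bound K A H j * c"
  shows "hnorm H u \<le> whp_bound K A H (j + i) * c"
  using assms(1) mult_left_mono[OF assms(2) whp_bound_nonneg[of i]]
  by (simp add: whp_bound_def power_add mult_ac)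

lemma gmres_restart_bound:
  assumes b: "b \<in> vecs_over K" and x0: "x0 \<in> vecs_over K" and x: "gmres_restart K A H b x0 k x"
  shows "hnorm H (b - A *v x i) \<le> whp_bound K A H i * hnorm H (b - A *v x0)"
proof -
  have iter: "gmres_iterate K A H b (x (m * (k + 1))) l (x (m * (k + 1) + l))" if "1 \<le> l" "l \<le> k + 1" for m l
    using x that by (simp add: gmres_restart_def)
  have start: "x (m * (k + 1)) \<in> vecs_over K
      \<and> hnorm H (b - A *v x (m * (k + 1))) \<le> whp_bound K A H (m * (k + 1)) * hnorm H (b - A *v x0)" for m
  proof (induction m)
    case 0
    then show ?case using x x0 by (simp add: gmres_restart_def whp_bound_def)
  next
    case (Suc m)
    have next_start: "Suc m * (k + 1) = m * (k + 1) + (k + 1)" by simp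
    have it: "gmres_iterate K A H b (x (m * (k + 1))) (k + 1) (x (Suc m * (k + 1)))"
      unfolding next_start by (rule iter) auto
    show ?case
      using gmres_in[OF b _ it] whp_bound_chain[OF gmres_bound[OF b _ it]] Suc next_start by metis
  qed
  define m l where "m = i div (k + 1)" and "l = i mod (k + 1)"
  have i: "i = m * (k + 1) + l" unfolding m_def l_def by (rule div_mult_mod_eq[symmetric])
  have l: "l \<le> k + 1" using mod_less_divisor[of "k + 1" i] by (simp add: l_def)
  show ?thesis
  proof (cases "l = 0")
    case True
    then show ?thesis using start[of m] i by simp
  next
    case False
    then have it: "gmres_iterate K A H b (x (m * (k + 1))) l (x i)"
      unfolding i using l by (intro iter) auto
    show ?thesis
      using whp_bound_chain[OF gmres_bound[OF b _ it]] start[of m] i by metis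
  qed
qed

lemma gcr_bound:
  assumes "b \<in> vecs_over K" "x \<in> vecs_over K"
  shows "hnorm H (b - A *v gcr_x A H b x i) \<le> whp_bound K A H i * hnorm H (b - A *v x)"
  using orthomin_bound[OF assms, of i i] by (simp add: gcr_eq_orthomin[OF order_refl])

lemma gcr_in:
  assumes "b \<in> vecs_over K" "x \<in> vecs_over K"
  shows "gcr_x A H b x i \<in> vecs_over K"
  using orthomin_in[OF assms, of i i] by (simp add: gcr_eq_orthomin[OF order_refl])

lemma gcr_restart_bound:
  assumes b: "b \<in> vecs_over K" and x0: "x0 \<in> vecs_over K"
  shows "hnorm H (b - A *v gcr_restart_x A H b x0 k i) \<le> whp_bound K A H i * hnorm H (b - A *v x0)"
proof -
  have start: "gcr_start A H b x0 k m \<in> vecs_over K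
      \<and> hnorm H (b - A *v gcr_start A H b x0 k m) \<le> whp_bound K A H (m * (k + 1)) * hnorm H (b - A *v x0)" for m
  proof (induction m)
    case 0
    then show ?case using x0 by (simp add: gcr_start_def whp_bound_def)
  next
    case (Suc m)
    have next_start: "Suc m * (k + 1) = m * (k + 1) + (k + 1)" by simp
    have eq: "gcr_start A H b x0 k (Suc m) = gcr_x A H b (gcr_start A H b x0 k m) (k + 1)"
      unfolding gcr_start_def by (simp only: funpow.simps o_apply)
    show ?case
      unfolding eq next_start
      using gcr_in[OF b] whp_bound_chain[OF gcr_bound[OF b]] Suc by blast
  qed
  have "i div (k + 1) * (k + 1) + i mod (k + 1) = i" by (rule div_mult_mod_eq)
  then show ?thesis
    unfolding gcr_restart_x_def
    using whp_bound_chain[OF gcr_bound[OF b]] start[of "i div (k + 1)"] by metis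
qed

end

section \<open>The convergence estimate\<close>

theorem theorem5:
  fixes K :: "complex set" and A H :: "complex^'n^'n" and b x0 :: "complex^'n"
  assumes "K = \<real> \<or> K = UNIV"
    and "A \<in> mats_over K" and "H \<in> mats_over K"
    and "b \<in> vecs_over K" and "x0 \<in> vecs_over K"
    and "invertible A"
    and "herm_pos_def K H"
    and "b - A *v x0 \<noteq> 0"
  shows
    "(\<forall>i. (\<forall>j<i. gcr_delta A H b x0 j \<noteq> 0) \<longrightarrow>
        hnorm H (b - A *v gcr_x A H b x0 i) / hnorm H (b - A *v x0) \<le> whp_bound K A H i)
   \<and> (\<forall>i x. gmres_iterate K A H b x0 i x \<longrightarrow>
        hnorm H (b - A *v x) / hnorm H (b - A *v x0) \<le> whp_bound K A H i)
   \<and> (\<forall>k i. (\<forall>j<i. gcr_restart_delta A H b x0 k j \<noteq> 0) \<longrightarrow>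
        hnorm H (b - A *v gcr_restart_x A H b x0 k i) / hnorm H (b - A *v x0) \<le> whp_bound K A H i)
   \<and> (\<forall>k x i. gmres_restart K A H b x0 k x \<longrightarrow>
        hnorm H (b - A *v x i) / hnorm H (b - A *v x0) \<le> whp_bound K A H i)
   \<and> (\<forall>k\<ge>1. \<forall>i. (\<forall>j<i. orthomin_delta A H b x0 k j \<noteq> 0) \<longrightarrow>
        hnorm H (b - A *v orthomin_x A H b x0 k i) / hnorm H (b - A *v x0) \<le> whp_bound K A H i)
   \<and> (\<forall>i. (\<forall>j<i. mr_delta A H b x0 j \<noteq> 0) \<longrightarrow>
        hnorm H (b - A *v mr_x A H b x0 i) / hnorm H (b - A *v x0) \<le> whp_bound K A H i)"
proof -
  interpret hermitian_preconditioning K A H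
    using assms by unfold_locales
  have "hnorm H (b - A *v x0) > 0"
    using assms(8) by (rule hnorm_pos)
  then have quotient: "u / hnorm H (b - A *v x0) \<le> whp_bound K A H i"
    if "u \<le> whp_bound K A H i * hnorm H (b - A *v x0)" for u i
    using that by (simp add: pos_divide_le_eq)
  show ?thesis
    using gcr_bound gmres_bound gcr_restart_bound gmres_restart_bound orthomin_bound mr_bound assms(4,5)
    by (intro conjI allI impI quotient) blast+
qed

end
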